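(* Let $d, N$ be integers with $2 \leq d < N$, let $0 < c_1 < c_2$ be real numbers, and let $\sigma \geq 0$ satisfy $\sigma \leq c_1 \sqrt{(N-d)/d}$. Then $$\max_{\substack{v_1, \ldots, v_N \in \sqrt{c}\, S^{d-1} \\ c_1 \leq c \leq c_2}} \ \min_{1 \leq k \leq N} N \log\left(1 + \frac{|v_k|^2}{\sigma^2 + \sum_{l \neq k} \langle v_k, v_l \rangle^2}\right) = N \log\left(1 + \frac{c_1}{\sigma^2 + c_1^2 (N-d)/d}\right),$$ where the maximum is over all $c \in [c_1, c_2]$ and all vector systems $v_1,\ldots,v_N \in \sqrt{c}\,S^{d-1}$.
   Context: $|\cdot|$ and $\langle \cdot,\cdot\rangle$ are the Euclidean norm and inner product on $\mathbb{R}^d$, and $S^{d-1}$ is the Euclidean unit sphere of $\mathbb{R}^d$. Sums $\sum_{l \neq k}$ run over $l \in \{1,\ldots,N\}\setminus\{k\}$. Convention: a positive number divided by $0$ equals $+\infty$, and $\log(+\infty)=+\infty$. The logarithm is taken to any fixed base greater than $1$ (the same on both sides). Vector systems are indexed families (repetitions are allowed). *)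

theory Defs
  imports "HOL-Analysis.Analysis"
begin

text \<open>
  Logarithm to base \<open>b > 1\<close> on the extended reals, with \<open>log \<infinity> = \<infinity>\<close>. It is only meaningful
  for arguments in \<open>(0, \<infinity>]\<close>; below it is only applied to arguments \<open>\<ge> 1\<close>.
\<close>
definition ereal_log :: "real \<Rightarrow> ereal \<Rightarrow> ereal" where
  "ereal_log b x = (if x = \<infinity> then \<infinity> else ereal (log b (real_of_ereal x)))"

text \<open>
  Division on \<^typ>\<open>ereal\<close> satisfies \<open>x / 0 = \<infinity>\<close> for \<open>x > 0\<close>, so a vanishing denominator gives
  \<open>\<infinity>\<close>; with real division it would give \<open>0\<close>.
\<close>
definition user_rate :: "real \<Rightarrow> real \<Rightarrow> nat \<Rightarrow> (nat \<Rightarrow> real ^ 'd) \<Rightarrow> nat \<Rightarrow> ereal" where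
  "user_rate b \<sigma> N v k =
     ereal (real N) *
     ereal_log b (1 + ereal ((norm (v k))\<^sup>2) /
                      ereal (\<sigma>\<^sup>2 + (\<Sum>l\<in>{1..N} - {k}. (v k \<bullet> v l)\<^sup>2)))"

definition min_rate :: "real \<Rightarrow> real \<Rightarrow> nat \<Rightarrow> (nat \<Rightarrow> real ^ 'd) \<Rightarrow> ereal" where
  "min_rate b \<sigma> N v = Min (user_rate b \<sigma> N v ` {1..N})"

text \<open>
  Systems \<open>v 1, \<dots>, v N\<close> on a common sphere of radius \<open>sqrt c\<close>, where \<open>c\<close> ranges over
  \<open>[c\<^sub>1, c\<^sub>2]\<close>. Values of \<open>v\<close> outside \<open>{1..N}\<close> are irrelevant.
\<close>
definition vector_systems :: "real \<Rightarrow> real \<Rightarrow> nat \<Rightarrow> (nat \<Rightarrow> real ^ 'd) set" where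
  "vector_systems c\<^sub>1 c\<^sub>2 N =
     {v. \<exists>c\<in>{c\<^sub>1..c\<^sub>2}. \<forall>k\<in>{1..N}. v k \<in> sphere 0 (sqrt c)}"

text \<open>Attained maximum of a possibly infinite set (\<^const>\<open>Max\<close> is only meaningful for finite sets).\<close>
definition is_maximum :: "'a::order set \<Rightarrow> 'a \<Rightarrow> bool" where
  "is_maximum A m \<longleftrightarrow> m \<in> A \<and> (\<forall>x\<in>A. x \<le> m)"

end

theory Submission
  imports Defs
begin

text \<open>
  Expanding in an orthonormal basis and applying Cauchy--Schwarz gives the Welch bound
  \<open>\<Sum>k l. (v k \<bullet> v l)\<^sup>2 \<ge> (\<Sum>k. |v k|\<^sup>2)\<^sup>2 / d\<close>, so some user of a system of squared length \<open>c\<close>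
  suffers interference at least \<open>c\<^sup>2 (N - d) / d\<close>. The noise bound makes
  \<open>c / (\<sigma>\<^sup>2 + c\<^sup>2 (N - d) / d)\<close> decreasing on \<open>c \<ge> c\<^sub>1\<close>. Equality holds for every user of an equal-norm
  tight frame, obtained from an orthogonal basis padded with zeros by rotating pairs of vectors.
\<close>

lemma sum_norm_square_Basis:
  fixes v :: "'i \<Rightarrow> 'a::euclidean_space"
  shows "(\<Sum>i\<in>S. (norm (v i))\<^sup>2) = (\<Sum>b\<in>Basis. \<Sum>i\<in>S. (v i \<bullet> b)\<^sup>2)"
proof -
  have "(\<Sum>i\<in>S. (norm (v i))\<^sup>2) = (\<Sum>i\<in>S. \<Sum>b\<in>Basis. (v i \<bullet> b)\<^sup>2)"
    by (intro sum.cong refl)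
      (metis (no_types, lifting) euclidean_inner power2_eq_square power2_norm_eq_inner sum.cong)
  then show ?thesis by (simp add: sum.swap[of _ Basis S])
qed

text \<open>The matrix \<open>G\<close> of the frame operator has trace equal to the total squared
  norm, and its squared Frobenius norm equals that of the Gram matrix. Cauchy-Schwarz on the
  diagonal relates the two.\<close>

lemma welch_bound:
  fixes v :: "'i \<Rightarrow> 'a::euclidean_space"
  shows "(\<Sum>k\<in>S. (norm (v k))\<^sup>2)\<^sup>2 \<le> real DIM('a) * (\<Sum>k\<in>S. \<Sum>l\<in>S. (v k \<bullet> v l)\<^sup>2)"
proof -
  define G where "G a b = (\<Sum>k\<in>S. (v k \<bullet> a) * (v k \<bullet> b))" for a b
  have "(\<Sum>k\<in>S. (norm (v k))\<^sup>2)\<^sup>2 = (\<Sum>b\<in>Basis. 1 * G b b)\<^sup>2"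
    by (simp add: sum_norm_square_Basis G_def flip: power2_eq_square)
  also have "\<dots> \<le> (\<Sum>b\<in>(Basis::'a set). 1\<^sup>2) * (\<Sum>b\<in>Basis. (G b b)\<^sup>2)"
    by (rule Cauchy_Schwarz_ineq_sum)
  \<comment> \<open>Each diagonal entry squared is one of the nonnegative terms of its row
    sum.\<close>
  also have "\<dots> \<le> real DIM('a) * (\<Sum>a\<in>Basis. \<Sum>b\<in>Basis. (G a b)\<^sup>2)"
    by (auto intro!: mult_left_mono sum_mono member_le_sum)
  also have "(\<Sum>a\<in>Basis. \<Sum>b\<in>Basis. (G a b)\<^sup>2)
      = (\<Sum>a\<in>Basis. \<Sum>b\<in>Basis. \<Sum>k\<in>S. \<Sum>l\<in>S. (v k \<bullet> a) * (v l \<bullet> a) * ((v k \<bullet> b) * (v l \<bullet> b)))"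
    by (simp add: G_def power2_eq_square sum_product mult_ac)
  \<comment> \<open>With the vector indices outermost, the two basis sums factor into
    \<open>v k \<bullet> v l\<close> times itself.\<close>
  also have "\<dots> = (\<Sum>k\<in>S. \<Sum>l\<in>S. \<Sum>a\<in>Basis. \<Sum>b\<in>Basis. (v k \<bullet> a) * (v l \<bullet> a) * ((v k \<bullet> b) * (v l \<bullet> b)))"
    by (simp add: sum.swap[of _ S Basis])
  also have "\<dots> = (\<Sum>k\<in>S. \<Sum>l\<in>S. (v k \<bullet> v l)\<^sup>2)"
    by (simp add: euclidean_inner[of "v _" "v _"] power2_eq_square sum_product)
  finally show ?thesis .
qed

text \<open>Rotating the pair \<open>(u, w)\<close> by an angle preserves the sum of the two
  rank-one forms, hence also its trace. The norm of the first rotated vector moves continuously from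
  that of \<open>u\<close> to that of \<open>w\<close>, so it attains every value between.\<close>

lemma rotation_with_prescribed_norm:
  fixes u w :: "'a::real_inner"
  assumes "(norm u)\<^sup>2 \<le> m" "m \<le> (norm w)\<^sup>2"
  obtains p q where "(norm p)\<^sup>2 = m" "\<And>x. (p \<bullet> x)\<^sup>2 + (q \<bullet> x)\<^sup>2 = (u \<bullet> x)\<^sup>2 + (w \<bullet> x)\<^sup>2"
    "(norm p)\<^sup>2 + (norm q)\<^sup>2 = (norm u)\<^sup>2 + (norm w)\<^sup>2"
proof -
  define f where "f t = (norm (cos t *\<^sub>R u + sin t *\<^sub>R w))\<^sup>2" for t :: real
  have "\<exists>t\<ge>0. t \<le> pi/2 \<and> f t = m"
    using assms by (intro IVT') (auto simp: f_def intro!: continuous_intros)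
  then obtain t where t: "f t = m" by blast
  have sc: "(cos t)\<^sup>2 = 1 - (sin t)\<^sup>2" by (simp add: cos_squared_eq)
  show thesis
  proof
    show "(norm (cos t *\<^sub>R u + sin t *\<^sub>R w))\<^sup>2 = m"
      using t by (simp add: f_def)
    show "((cos t *\<^sub>R u + sin t *\<^sub>R w) \<bullet> x)\<^sup>2 + ((cos t *\<^sub>R w - sin t *\<^sub>R u) \<bullet> x)\<^sup>2
        = (u \<bullet> x)\<^sup>2 + (w \<bullet> x)\<^sup>2" for x
      by (simp add: inner_simps power2_sum power2_diff power_mult_distrib sc) (simp add: algebra_simps)
    show "(norm (cos t *\<^sub>R u + sin t *\<^sub>R w))\<^sup>2 + (norm (cos t *\<^sub>R w - sin t *\<^sub>R u))\<^sup>2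
        = (norm u)\<^sup>2 + (norm w)\<^sup>2"
      using sc unfolding power2_norm_eq_inner
      by (simp add: inner_simps inner_commute power2_eq_square) algebra
  qed
qed

text \<open>Induction on the cardinality: a vector below the mean \<open>m\<close> is rotated
  against one above it until one of the two has squared norm exactly \<open>m\<close>. That one is
  set aside, and the remaining vectors still have mean \<open>m\<close>.\<close>

lemma equalize_norms:
  fixes v :: "'i \<Rightarrow> 'a::real_inner"
  assumes "finite S" "(\<Sum>i\<in>S. (norm (v i))\<^sup>2) = real (card S) * m"
  shows "\<exists>w. (\<forall>i\<in>S. (norm (w i))\<^sup>2 = m) \<and> (\<forall>x. (\<Sum>i\<in>S. (w i \<bullet> x)\<^sup>2) = (\<Sum>i\<in>S. (v i \<bullet> x)\<^sup>2))"
  using assms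
proof (induction "card S" arbitrary: S v)
  case 0
  then show ?case by auto
next
  case (Suc n)
  show ?case
  proof (cases "\<forall>i\<in>S. (norm (v i))\<^sup>2 = m")
    case True
    then show ?thesis by blast
  next
    case False
    have S: "finite S" "(\<Sum>i\<in>S. (norm (v i))\<^sup>2) = (\<Sum>i\<in>S. m)" using Suc.prems by auto
    \<comment> \<open>The mean is \<open>m\<close> and not all squared norms equal it, so some lie
      strictly on each side.\<close>
    have "\<exists>i\<in>S. (norm (v i))\<^sup>2 < m"
    proof (rule ccontr)
      assume "\<not> ?thesis"
      then have ge: "\<And>i. i \<in> S \<Longrightarrow> m \<le> (norm (v i))\<^sup>2" by force
      with False have "\<exists>i\<in>S. m < (norm (v i))\<^sup>2" by force
      then have "(\<Sum>i\<in>S. m) < (\<Sum>i\<in>S. (norm (v i))\<^sup>2)"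
        using ge S(1) by (intro sum_strict_mono_ex1) auto
      with S(2) show False by simp
    qed
    then obtain i where i: "i \<in> S" "(norm (v i))\<^sup>2 < m" by blast
    have "\<exists>j\<in>S. m < (norm (v j))\<^sup>2"
    proof (rule ccontr)
      assume "\<not> ?thesis"
      then have "(\<Sum>i\<in>S. (norm (v i))\<^sup>2) < (\<Sum>i\<in>S. m)"
        using i S(1) by (intro sum_strict_mono_ex1) force+
      with S(2) show False by simp
    qed
    then obtain j where j: "j \<in> S" "m < (norm (v j))\<^sup>2" by blast
    have ij: "i \<noteq> j" using i j by auto
    obtain p q where p: "(norm p)\<^sup>2 = m"
      and pq: "\<And>x. (p \<bullet> x)\<^sup>2 + (q \<bullet> x)\<^sup>2 = (v i \<bullet> x)\<^sup>2 + (v j \<bullet> x)\<^sup>2"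
        "(norm p)\<^sup>2 + (norm q)\<^sup>2 = (norm (v i))\<^sup>2 + (norm (v j))\<^sup>2"
      using rotation_with_prescribed_norm[of "v i" m "v j"] i j by (metis less_imp_le)
    \<comment> \<open>Index \<open>i\<close> is finished and will carry \<open>p\<close>; the other
      rotated vector \<open>q\<close> takes over the slot \<open>j\<close> and enters the
      recursion.\<close>
    define T where "T = S - {i}"
    have T: "finite T" "n = card T" "j \<in> T" "i \<notin> T" "S = insert i T"
      using S i j ij Suc.hyps(2) by (auto simp: T_def)
    have split: "(\<Sum>k\<in>T. g (u k)) = g (u j) + (\<Sum>k\<in>T - {j}. g (u k))"
      for g :: "'a \<Rightarrow> real" and u using T by (simp add: sum.remove)
    define v' where "v' = v(j := q)"
    have rest: "(\<Sum>k\<in>T - {j}. g (v' k)) = (\<Sum>k\<in>T - {j}. g (v k))" for g :: "'a \<Rightarrow> real"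
      by (intro sum.cong) (auto simp: v'_def)
    have "(\<Sum>k\<in>T. (norm (v' k))\<^sup>2) = real (card T) * m"
      using Suc.prems(2) p pq(2) T(1,2,4,5) split[of "\<lambda>y. (norm y)\<^sup>2" v] split[of "\<lambda>y. (norm y)\<^sup>2" v']
        rest[of "\<lambda>y. (norm y)\<^sup>2"]
      by (simp add: v'_def algebra_simps)
    from Suc.hyps(1)[OF T(2,1) this] obtain w where w: "\<forall>k\<in>T. (norm (w k))\<^sup>2 = m"
      "\<And>x. (\<Sum>k\<in>T. (w k \<bullet> x)\<^sup>2) = (\<Sum>k\<in>T. (v' k \<bullet> x)\<^sup>2)" by blast
    have "(\<Sum>k\<in>S. ((w(i := p)) k \<bullet> x)\<^sup>2) = (\<Sum>k\<in>S. (v k \<bullet> x)\<^sup>2)" for x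
    proof -
      have "(\<Sum>k\<in>T. ((w(i := p)) k \<bullet> x)\<^sup>2) = (\<Sum>k\<in>T. (w k \<bullet> x)\<^sup>2)"
        using T(4) by (intro sum.cong) auto
      then show ?thesis
        using w(2)[of x] pq(1)[of x] T(1,4,5) split[of "\<lambda>y. (y \<bullet> x)\<^sup>2" v]
          split[of "\<lambda>y. (y \<bullet> x)\<^sup>2" v'] rest[of "\<lambda>y. (y \<bullet> x)\<^sup>2"]
        by (simp add: v'_def)
    qed
    moreover have "\<forall>k\<in>S. (norm ((w(i := p)) k))\<^sup>2 = m"
      using w(1) p T by auto
    ultimately show ?thesis by blast
  qed
qed

lemma equal_norm_tight_frame_exists:
  assumes "DIM('a::euclidean_space) \<le> N" "0 \<le> c"
  shows "\<exists>v::nat \<Rightarrow> 'a. (\<forall>k\<in>{1..N}. (norm (v k))\<^sup>2 = c) \<and>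
    (\<forall>x. (\<Sum>k\<in>{1..N}. (v k \<bullet> x)\<^sup>2) = real N * c / real DIM('a) * (norm x)\<^sup>2)"
proof -
  \<comment> \<open>The frame constant is forced by the trace: dimension times \<open>a\<close> must
    equal the total squared norm \<open>N * c\<close>.\<close>
  define a where "a = real N * c / real DIM('a)"
  have a: "0 \<le> a" using assms by (simp add: a_def)
  obtain e where e: "bij_betw e {1..DIM('a)} (Basis::'a set)"
    using ex_bij_betw_nat_finite_1[OF finite_Basis] by blast
  \<comment> \<open>This family is already tight; only its norms are unequal, and equalizing them
    leaves the quadratic form unchanged.\<close>
  define u :: "nat \<Rightarrow> 'a" where "u k = (if k \<le> DIM('a) then sqrt a *\<^sub>R e k else 0)" for k
  have u: "(\<Sum>k\<in>{1..N}. (u k \<bullet> x)\<^sup>2) = a * (norm x)\<^sup>2" for x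
  proof -
    have "(\<Sum>k\<in>{1..N}. (u k \<bullet> x)\<^sup>2) = (\<Sum>k\<in>{1..DIM('a)}. (u k \<bullet> x)\<^sup>2)"
      using assms by (intro sum.mono_neutral_right) (auto simp: u_def)
    also have "\<dots> = (\<Sum>k\<in>{1..DIM('a)}. a * (e k \<bullet> x)\<^sup>2)"
      using a by (intro sum.cong) (auto simp: u_def power_mult_distrib)
    also have "\<dots> = (\<Sum>b\<in>Basis. a * (b \<bullet> x)\<^sup>2)"
      by (rule sum.reindex_bij_betw[OF e])
    also have "\<dots> = a * (norm x)\<^sup>2"
      using sum_norm_square_Basis[of "\<lambda>_. x" "{()}"] by (simp add: sum_distrib_left inner_commute)
    finally show ?thesis .
  qed
  \<comment> \<open>Summing the tightness identity over the basis vectors gives the trace.\<close>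
  have "(\<Sum>k\<in>{1..N}. (norm (u k))\<^sup>2) = real (card {1..N}) * c"
    unfolding sum_norm_square_Basis by (simp add: u[simplified] a_def)
  from equalize_norms[OF _ this] show ?thesis
    by (simp add: u[simplified] a_def)
qed

text \<open>A positive denominator rules out the infinite case, so rates can be compared as real
  numbers.\<close>

lemma user_rate_eq:
  assumes "b > 1" "\<sigma>\<^sup>2 + (\<Sum>l\<in>{1..N} - {k}. (v k \<bullet> v l)\<^sup>2) > 0"
  shows "user_rate b \<sigma> N v k =
    ereal (real N * log b (1 + (norm (v k))\<^sup>2 / (\<sigma>\<^sup>2 + (\<Sum>l\<in>{1..N} - {k}. (v k \<bullet> v l)\<^sup>2))))"
  using assms by (simp add: user_rate_def ereal_log_def add.commute)

lemma sum_interference: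
  fixes v :: "nat \<Rightarrow> 'a::real_inner"
  assumes "k \<in> {1..N}"
  shows "(\<Sum>l\<in>{1..N} - {k}. (v k \<bullet> v l)\<^sup>2) = (\<Sum>l\<in>{1..N}. (v k \<bullet> v l)\<^sup>2) - ((norm (v k))\<^sup>2)\<^sup>2"
  using sum.remove[OF finite_atLeastAtMost assms, of "\<lambda>l. (v k \<bullet> v l)\<^sup>2"] by (simp add: power2_norm_eq_inner)

text \<open>Averaging: if every user were below the bound, restoring the diagonal terms
  \<open>c\<^sup>2\<close> and summing over \<open>k\<close> would give a total below
  \<open>(N * c)\<^sup>2 / D\<close>, against the Welch bound.\<close>

lemma exists_large_interference:
  fixes v :: "nat \<Rightarrow> 'a::euclidean_space"
  assumes "N > 0" "\<And>k. k \<in> {1..N} \<Longrightarrow> (norm (v k))\<^sup>2 = c"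
  shows "\<exists>k\<in>{1..N}. c\<^sup>2 * ((real N - real DIM('a)) / real DIM('a))
    \<le> (\<Sum>l\<in>{1..N} - {k}. (v k \<bullet> v l)\<^sup>2)"
proof (rule ccontr)
  define D where "D = real DIM('a)"
  have D: "D > 0" by (simp add: D_def)
  assume no: "\<not> ?thesis"
  have "(\<Sum>l\<in>{1..N}. (v k \<bullet> v l)\<^sup>2) < c\<^sup>2 * ((real N - D) / D) + c\<^sup>2" if k: "k \<in> {1..N}" for k
  proof -
    have "(\<Sum>l\<in>{1..N} - {k}. (v k \<bullet> v l)\<^sup>2) < c\<^sup>2 * ((real N - D) / D)"
      using no k unfolding D_def by (meson not_le)
    then show ?thesis
      unfolding sum_interference[OF k] assms(2)[OF k] by linarith
  qed
  then have "(\<Sum>k\<in>{1..N}. \<Sum>l\<in>{1..N}. (v k \<bullet> v l)\<^sup>2) < (\<Sum>k\<in>{1..N}. c\<^sup>2 * ((real N - D) / D) + c\<^sup>2)"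
    using assms(1) by (intro sum_strict_mono) auto
  also have "\<dots> = (real N * c)\<^sup>2 / D"
    using D by (simp add: field_simps power2_eq_square)
  also have "real N * c = (\<Sum>k\<in>{1..N}. (norm (v k))\<^sup>2)"
    using assms(2) by simp
  finally show False
    using welch_bound[of v "{1..N}"] D by (simp add: D_def field_simps)
qed

text \<open>The function \<open>c / (s + c\<^sup>2 * a)\<close> decreases once
  \<open>c\<^sup>2 * a\<close> is at least \<open>s\<close>, which holds from
  \<open>c\<^sub>1\<close> on. After cross-multiplication the difference factors as
  \<open>(c - c\<^sub>1) * (c\<^sub>1 * c * a - s)\<close>.\<close>

lemma signal_ratio_antimono:
  fixes a s c\<^sub>1 c i :: real
  assumes "0 < a" "0 < c\<^sub>1" "c\<^sub>1 \<le> c" "0 \<le> s" "s \<le> c\<^sub>1\<^sup>2 * a" "c\<^sup>2 * a \<le> i"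
  shows "c / (s + i) \<le> c\<^sub>1 / (s + c\<^sub>1\<^sup>2 * a)"
proof -
  have pos: "0 < s + c\<^sub>1\<^sup>2 * a" "0 < s + c\<^sup>2 * a"
    using assms by (auto intro!: add_nonneg_pos)
  have "c\<^sub>1\<^sup>2 * a \<le> c\<^sub>1 * c * a"
    using assms by (simp add: power2_eq_square)
  with assms have "0 \<le> (c - c\<^sub>1) * (c\<^sub>1 * c * a - s)"
    by (intro mult_nonneg_nonneg) linarith+
  then have "c * (s + c\<^sub>1\<^sup>2 * a) \<le> c\<^sub>1 * (s + c\<^sup>2 * a)"
    by (simp add: algebra_simps power2_eq_square)
  then have "c / (s + c\<^sup>2 * a) \<le> c\<^sub>1 / (s + c\<^sub>1\<^sup>2 * a)"
    using pos by (simp add: divide_simps mult_ac)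
  moreover have "c / (s + i) \<le> c / (s + c\<^sup>2 * a)"
    using assms pos by (intro divide_left_mono) auto
  ultimately show ?thesis by linarith
qed

theorem corollary2:
  fixes N :: nat and b c\<^sub>1 c\<^sub>2 \<sigma> :: real
  assumes "b > 1"
    and "2 \<le> CARD('d::finite)" and "CARD('d) < N"
    and "0 < c\<^sub>1" and "c\<^sub>1 < c\<^sub>2"
    and "0 \<le> \<sigma>"
    and "\<sigma> \<le> c\<^sub>1 * sqrt ((real N - real CARD('d)) / real CARD('d))"
  shows "is_maximum
           (min_rate b \<sigma> N ` (vector_systems c\<^sub>1 c\<^sub>2 N :: (nat \<Rightarrow> real ^ 'd) set))
           (ereal (real N *
              log b (1 + c\<^sub>1 / (\<sigma>\<^sup>2 + c\<^sub>1\<^sup>2 * (real N - real CARD('d)) / real CARD('d)))))"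
proof -
  define a where "a = (real N - real CARD('d)) / real CARD('d)"
  define m where "m = ereal (real N * log b (1 + c\<^sub>1 / (\<sigma>\<^sup>2 + c\<^sub>1\<^sup>2 * a)))"
  have a: "a > 0" using assms by (simp add: a_def)
  have "\<sigma>\<^sup>2 \<le> (c\<^sub>1 * sqrt a)\<^sup>2"
    using assms by (intro power_mono) (auto simp: a_def)
  then have \<sigma>: "\<sigma>\<^sup>2 \<le> c\<^sub>1\<^sup>2 * a"
    using a by (simp add: power_mult_distrib)
  \<comment> \<open>Since \<open>N\<close> exceeds the dimension, denominators stay positive even
    for \<open>\<sigma> = 0\<close>.\<close>
  have pos: "\<sigma>\<^sup>2 + c\<^sup>2 * a > 0" if "c > 0" for c
    using a that by (intro add_nonneg_pos) auto
  have N: "N > 0" using assms by simp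
  \<comment> \<open>The maximizer is an equal-norm tight frame at the smallest admissible squared
    length.\<close>
  obtain w :: "nat \<Rightarrow> real ^ 'd" where w: "\<And>k. k \<in> {1..N} \<Longrightarrow> (norm (w k))\<^sup>2 = c\<^sub>1"
    "\<And>x. (\<Sum>k\<in>{1..N}. (w k \<bullet> x)\<^sup>2) = real N * c\<^sub>1 / real CARD('d) * (norm x)\<^sup>2"
    using equal_norm_tight_frame_exists[where 'a = "real ^ 'd", of N c\<^sub>1] assms
    by (metis DIM_cart DIM_real less_imp_le mult.right_neutral)
  have rate_w: "user_rate b \<sigma> N w k = m" if k: "k \<in> {1..N}" for k
  proof -
    \<comment> \<open>Tightness is evaluated at \<open>x = w k\<close>, then the diagonal term is
      removed.\<close>
    have "(\<Sum>l\<in>{1..N} - {k}. (w k \<bullet> w l)\<^sup>2) = real N * c\<^sub>1 / real CARD('d) * c\<^sub>1 - c\<^sub>1\<^sup>2"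
      unfolding sum_interference[OF k]
      by (simp only: inner_commute[of "w k"] w(2) w(1)[OF k])
    also have "\<dots> = c\<^sub>1\<^sup>2 * a"
      by (simp add: a_def field_simps power2_eq_square)
    finally have "(\<Sum>l\<in>{1..N} - {k}. (w k \<bullet> w l)\<^sup>2) = c\<^sub>1\<^sup>2 * a" .
    then show ?thesis
      using user_rate_eq[of b \<sigma> w k N] assms pos w(1)[OF k] by (simp add: m_def)
  qed
  have "user_rate b \<sigma> N w ` {1..N} = {m}"
    using rate_w N by (force simp: image_iff)
  then have "min_rate b \<sigma> N w = m" by (simp add: min_rate_def)
  moreover have "w \<in> vector_systems c\<^sub>1 c\<^sub>2 N"
    unfolding vector_systems_def using assms w(1)
    by (auto intro!: bexI[of _ c\<^sub>1] real_sqrt_unique[symmetric])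
  moreover have "min_rate b \<sigma> N v \<le> m" if "v \<in> vector_systems c\<^sub>1 c\<^sub>2 N" for v :: "nat \<Rightarrow> real ^ 'd"
  proof -
    from that obtain c where c: "c\<^sub>1 \<le> c" "\<And>k. k \<in> {1..N} \<Longrightarrow> norm (v k) = sqrt c"
      by (auto simp: vector_systems_def)
    have c0: "c > 0" using c assms by simp
    have v: "(norm (v k))\<^sup>2 = c" if "k \<in> {1..N}" for k
      using c(2)[OF that] c0 by simp
    \<comment> \<open>The rate of a single user with large interference already bounds the
      minimum.\<close>
    obtain k where k: "k \<in> {1..N}" and i: "c\<^sup>2 * a \<le> (\<Sum>l\<in>{1..N} - {k}. (v k \<bullet> v l)\<^sup>2)" (is "_ \<le> ?i")
      using exists_large_interference[of N v c] N v by (auto simp: a_def)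
    have ipos: "\<sigma>\<^sup>2 + ?i > 0" using pos[OF c0] i by linarith
    have "c / (\<sigma>\<^sup>2 + ?i) \<le> c\<^sub>1 / (\<sigma>\<^sup>2 + c\<^sub>1\<^sup>2 * a)"
      using a assms c \<sigma> i by (intro signal_ratio_antimono) auto
    \<comment> \<open>This keeps the smaller argument of the logarithm positive, as monotonicity
      requires.\<close>
    moreover have "0 < c / (\<sigma>\<^sup>2 + ?i)" using c0 ipos by simp
    ultimately have "user_rate b \<sigma> N v k \<le> m"
      unfolding m_def user_rate_eq[OF assms(1) ipos] v[OF k] ereal_less_eq
      using assms(1) by (intro mult_left_mono log_mono) auto
    moreover have "min_rate b \<sigma> N v \<le> user_rate b \<sigma> N v k"
      unfolding min_rate_def using k by (intro Min_le) auto
    ultimately show ?thesis by order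
  qed
  ultimately have "is_maximum (min_rate b \<sigma> N ` (vector_systems c\<^sub>1 c\<^sub>2 N :: (nat \<Rightarrow> real ^ 'd) set)) m"
    unfolding is_maximum_def by (force intro: rev_image_eqI)
  then show ?thesis by (simp add: m_def a_def)
qed

end
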